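(* Let $0<q<1$, $\alpha,\beta>-1$ and $s>0$. Define rational functions in $t$ by $$p_n^{(\alpha,\beta)}(t;q,\mathrm{rat}):={}_2\phi_2\!\left(\begin{matrix}q^{-n},\,q^{n+\alpha+\beta+1}\\ q^{\alpha+1},\,-tq^{\beta+1}\end{matrix};q,-tq\right)\qquad(n\in\mathbb{Z}_{\ge0}).$$ Then for all $n,m\in\mathbb{Z}_{\ge0}$, \begin{align*} &\frac{\Gamma_q(\alpha+\beta+2)}{\Gamma_q(\alpha+1)\,\Gamma_q(\beta+1)}\int_0^{s\cdot\infty} p_n^{(\alpha,\beta)}(t;q,\mathrm{rat})\;p_m^{(\beta,\alpha)}(t^{-1}q;q,\mathrm{rat})\;\frac{t^{-1}\,(-tq^{\beta+1},-t^{-1}q^{\alpha+2};q)_\infty}{(-t,-t^{-1}q;q)_\infty}\,d_qt\\ &\qquad=\frac{(-1)^n\,(1-q^{n+\alpha+\beta+1})\,(q;q)_n\,\delta_{n,m}}{q^{\frac12 n(n-1)}\,(1-q^{2n+\alpha+\beta+1})\,(q^{\alpha+\beta+2};q)_n}. \end{align*}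
   Context: $q$-shifted factorials: for $k\in\mathbb{Z}_{\ge0}$, $(x;q)_k:=\prod_{j=0}^{k-1}(1-xq^j)$, $(x;q)_\infty:=\prod_{j=0}^{\infty}(1-xq^j)$, and $(x_1,\dots,x_r;q)_k:=\prod_{i=1}^r (x_i;q)_k$ for $k\in\mathbb{Z}_{\ge0}\cup\{\infty\}$. Basic hypergeometric series: $${}_2\phi_2\!\left(\begin{matrix}a_1,a_2\\ b_1,b_2\end{matrix};q,z\right):=\sum_{j\ge0}\frac{(a_1,a_2;q)_j}{(b_1,b_2,q;q)_j}\,(-1)^jq^{\frac12 j(j-1)}\,z^j,$$ which for $a_1=q^{-n}$ ($n\in\mathbb{Z}_{\ge0}$) is the finite sum over $0\le j\le n$. The $q$-gamma function is $\Gamma_q(z):=\dfrac{(q;q)_\infty}{(q^z;q)_\infty}(1-q)^{1-z}$. The $q$-integral on $(0,\infty)$ is defined, for $s>0$ and any function $f$ on $(0,\infty)$ for which the sum converges absolutely, by $$\int_0^{s\cdot\infty} f(t)\,d_qt:=(1-q)\sum_{k=-\infty}^{\infty} sq^k\,f(sq^k).$$ For $n=0$ the quotient $\dfrac{1-q^{n+\alpha+\beta+1}}{1-q^{2n+\alpha+\beta+1}}$ is understood to be $1$, also when $\alpha+\beta+1=0$. $\delta_{n,m}$ is the Kronecker delta. *)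

theory Defs
  imports "HOL-Analysis.Analysis"
begin

definition qpoch :: "real \<Rightarrow> real \<Rightarrow> nat \<Rightarrow> real" where
  "qpoch x q k = (\<Prod>j<k. 1 - x * q ^ j)"

definition qpoch_inf :: "real \<Rightarrow> real \<Rightarrow> real" where
  "qpoch_inf x q = (\<Prod>j. 1 - x * q ^ j)"

definition phi22 :: "real \<Rightarrow> real \<Rightarrow> real \<Rightarrow> real \<Rightarrow> real \<Rightarrow> real \<Rightarrow> real" where
  "phi22 a1 a2 b1 b2 q z =
     (\<Sum>j. (qpoch a1 q j * qpoch a2 q j) / (qpoch b1 q j * qpoch b2 q j * qpoch q q j)
           * (- 1) ^ j * q ^ (j * (j - 1) div 2) * z ^ j)"

definition q_Gamma :: "real \<Rightarrow> real \<Rightarrow> real" where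
  "q_Gamma q z = qpoch_inf q q / qpoch_inf (q powr z) q * (1 - q) powr (1 - z)"

text \<open>
  The q-integral of \<open>f\<close> from \<open>0\<close> to \<open>s \<cdot> \<infinity>\<close> is only meaningful if the defining
  bilateral sum converges absolutely; since \<^const>\<open>infsum\<close> is \<open>0\<close> on non-summable families,
  this is kept as a separate predicate.
\<close>

definition q_integrable :: "real \<Rightarrow> real \<Rightarrow> (real \<Rightarrow> real) \<Rightarrow> bool" where
  "q_integrable q s f \<longleftrightarrow>
     (\<lambda>k::int. \<bar>s * q powi k * f (s * q powi k)\<bar>) summable_on UNIV"

definition q_integral :: "real \<Rightarrow> real \<Rightarrow> (real \<Rightarrow> real) \<Rightarrow> real" where
  "q_integral q s f = (1 - q) * (\<Sum>\<^sub>\<infinity>k::int. s * q powi k * f (s * q powi k))"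

definition p_rat :: "real \<Rightarrow> real \<Rightarrow> real \<Rightarrow> nat \<Rightarrow> real \<Rightarrow> real" where
  "p_rat q \<alpha> \<beta> n t =
     phi22 (q powr (- real n)) (q powr (real n + \<alpha> + \<beta> + 1))
           (q powr (\<alpha> + 1)) (- t * q powr (\<beta> + 1)) q (- t * q)"

definition rat_weight :: "real \<Rightarrow> real \<Rightarrow> real \<Rightarrow> real \<Rightarrow> real" where
  "rat_weight q \<alpha> \<beta> t =
     inverse t * (qpoch_inf (- t * q powr (\<beta> + 1)) q * qpoch_inf (- inverse t * q powr (\<alpha> + 2)) q)
       / (qpoch_inf (- t) q * qpoch_inf (- inverse t * q) q)"

end

theory Submission
  imports Defs
begin

text \<open>
  With \<open>a = q powr (\<alpha> + 1)\<close>, \<open>b = q powr (\<beta> + 1)\<close> and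
  \<open>w\<^sub>a\<^sub>,\<^sub>b(t) = (-tb, -qa/t; q)\<^sub>\<infinity> / (-t, -q/t; q)\<^sub>\<infinity>\<close>, the bilateral sum \<open>F(a, b)\<close>
  of \<open>w\<^sub>a\<^sub>,\<^sub>b\<close> over \<open>t = sq\<^sup>k\<close> equals \<open>(q, ab; q)\<^sub>\<infinity> / (a, b; q)\<^sub>\<infinity>\<close>, whatever \<open>s\<close> is
  (Ramanujan's \<open>\<^sub>1\<psi>\<^sub>1\<close> sum).  Indeed, shifting \<open>t\<close> to \<open>qt\<close> gives
  \<open>F(a, b) = (1 - ab) / (1 - b) F(a, bq)\<close>, and \<open>t \<mapsto> q/t\<close> exchanges \<open>a\<close> and \<open>b\<close>.  Hence
  \<open>F(a, b) (a, b; q)\<^sub>\<infinity> / (ab; q)\<^sub>\<infinity>\<close> is invariant under \<open>(a, b) \<mapsto> (aq, bq)\<close>; as \<open>F\<close> is monotone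
  in both arguments and the infinite products tend to \<open>1\<close> along this iteration, that quantity is
  constant, and its value is found at \<open>a = b = q\<close>, where the sum telescopes.

  The denominators of the two rational functions are absorbed by the weight, and quasi-periodicity
  of the theta function \<open>(-t, -q/t; q)\<^sub>\<infinity>\<close> turns each term \<open>t\<^sup>j\<^sup>-\<^sup>k w(t)\<close> into the kernel for
  \<open>(aq\<^sup>j, bq\<^sup>k)\<close> on a rescaled lattice.  What is left is a double sum, symmetric in
  \<open>(n, j)\<close> and \<open>(m, k)\<close>, whose sum over \<open>j\<close> is a \<open>q\<close>-Chu-Vandermonde sum that vanishes
  for \<open>k < n\<close>.
\<close>

section \<open>Bilateral sums and finite q-shifted factorials\<close>

text \<open>Nonnegativity makes both one-sided series converge unconditionally, so they can be glued
  along the splitting of the integers into k >= 0 and k <= -1.\<close>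

lemma has_sum_int_nonneg:
  fixes f :: "int \<Rightarrow> real"
  assumes "\<And>k. f k \<ge> 0"
    and "(\<lambda>n. f (int n)) sums a" and "(\<lambda>n. f (- int n - 1)) sums b"
  shows "(f has_sum (a + b)) UNIV"
proof -
  have a: "((\<lambda>n. f (int n)) has_sum a) UNIV" and b: "((\<lambda>n. f (- int n - 1)) has_sum b) UNIV"
    using assms by (auto intro!: norm_summable_imp_has_sum dest: sums_summable)
  have "(f has_sum a) (range int)"
    using a by (subst has_sum_reindex) (auto simp: o_def)
  moreover have "(f has_sum b) (range (\<lambda>n. - int n - 1))"
    using b by (subst has_sum_reindex) (auto simp: o_def inj_on_def)
  moreover have "range int \<inter> range (\<lambda>n. - int n - 1) = {}"
    by auto
  ultimately have "(f has_sum (a + b)) (range int \<union> range (\<lambda>n. - int n - 1))"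
    by (rule has_sum_Un_disjoint)
  moreover have "k \<in> range int \<union> range (\<lambda>n. - int n - 1)" for k
  proof (cases "k \<ge> 0")
    case True
    then show ?thesis by (auto intro!: range_eqI[of _ int "nat k"])
  next
    case False
    then show ?thesis by (auto intro!: range_eqI[of _ _ "nat (- k - 1)"])
  qed
  then have "range int \<union> range (\<lambda>n. - int n - 1) = UNIV"
    by blast
  ultimately show ?thesis by simp
qed

lemma has_sum_finite_sum:
  fixes f :: "'a \<Rightarrow> 'b \<Rightarrow> real"
  assumes "finite J" "\<And>j. j \<in> J \<Longrightarrow> (f j has_sum x j) A"
  shows "((\<lambda>i. \<Sum>j\<in>J. f j i) has_sum (\<Sum>j\<in>J. x j)) A"
  using assms by (induction J rule: finite_induct) (auto intro!: has_sum_add)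

lemma mult_less_1: "0 < x \<Longrightarrow> x < 1 \<Longrightarrow> 0 < y \<Longrightarrow> y < 1 \<Longrightarrow> x * y < (1::real)"
  using mult_strict_mono[of x 1 y 1] by simp

lemma qpoch_0 [simp]: "qpoch x q 0 = 1"
  by (simp add: qpoch_def)

lemma qpoch_Suc: "qpoch x q (Suc k) = qpoch x q k * (1 - x * q ^ k)"
  by (simp add: qpoch_def)

lemma qpoch_add: "qpoch x q (j + k) = qpoch x q j * qpoch (x * q ^ j) q k"
  by (induction k) (simp_all add: qpoch_Suc power_add mult_ac)

lemma qpoch_Suc': "qpoch x q (Suc k) = (1 - x) * qpoch (x * q) q k"
  using qpoch_add[of x q 1 k] by (simp add: qpoch_def)

section \<open>The weight function\<close>

text \<open>This is the weight without its factor 1/t, which cancels against the t of the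
  q-integral. The free parameters \<open>a\<close> and \<open>b\<close> can be multiplied by powers
  of \<open>q\<close> independently.\<close>

definition rat_kernel :: "real \<Rightarrow> real \<Rightarrow> real \<Rightarrow> real \<Rightarrow> real" where
  "rat_kernel q a b t = qpoch_inf (- (t * b)) q * qpoch_inf (- (q * a / t)) q
     / (qpoch_inf (- t) q * qpoch_inf (- (q / t)) q)"

context
  fixes q :: real
  assumes q: "0 < q" "q < 1"
begin

section \<open>Convergence, positivity and monotonicity of the infinite product\<close>

lemma q_mult_less_1: "x < 1 \<Longrightarrow> x * q ^ j < 1"
proof (cases "x \<ge> 0")
  case True
  assume "x < 1"
  have "x * q ^ j \<le> x"
    using True q by (simp add: mult_left_le power_le_one)
  with \<open>x < 1\<close> show ?thesis by simp
next
  case False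
  then have "x * q ^ j \<le> 0" using q by (simp add: mult_nonpos_nonneg)
  then show ?thesis by simp
qed

lemma q_powr_less_1: "x > 0 \<Longrightarrow> q powr x < 1"
  using q powr_less_mono2[of x q 1] by simp

lemma qpoch_pos: "x < 1 \<Longrightarrow> qpoch x q k > 0"
  unfolding qpoch_def using q_mult_less_1 by (intro prod_pos) auto

lemma convergent_prod_qpoch: "convergent_prod (\<lambda>j. 1 - x * q ^ j)"
proof -
  have "summable (\<lambda>j. norm (x * q ^ j))"
    unfolding norm_mult norm_power using q by (intro summable_mult summable_geometric) auto
  then have "abs_convergent_prod (\<lambda>j. 1 + (- (x * q ^ j)))"
    by (intro summable_imp_abs_convergent_prod) simp
  then show ?thesis
    using abs_convergent_prod_imp_convergent_prod by fastforce
qed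

lemma qpoch_tendsto: "(\<lambda>n. qpoch x q n) \<longlonglongrightarrow> qpoch_inf x q"
  using convergent_prod_LIMSEQ[OF convergent_prod_qpoch]
  by (simp add: LIMSEQ_lessThan_iff_atMost qpoch_def qpoch_inf_def)

lemma qpoch_inf_pos: "x < 1 \<Longrightarrow> qpoch_inf x q > 0"
  unfolding qpoch_inf_def
  using q_mult_less_1 by (intro less_0_prodinf convergent_prod_qpoch) auto

lemma qpoch_inf_split: "qpoch_inf x q = qpoch x q k * qpoch_inf (x * q ^ k) q"
proof (rule LIMSEQ_unique)
  show "(\<lambda>n. qpoch x q (n + k)) \<longlonglongrightarrow> qpoch_inf x q"
    using qpoch_tendsto by (rule LIMSEQ_ignore_initial_segment)
  show "(\<lambda>n. qpoch x q (n + k)) \<longlonglongrightarrow> qpoch x q k * qpoch_inf (x * q ^ k) q"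
    unfolding add.commute[of _ k] qpoch_add by (intro tendsto_intros qpoch_tendsto)
qed

lemma qpoch_inf_step: "qpoch_inf x q = (1 - x) * qpoch_inf (x * q) q"
  using qpoch_inf_split[of x 1] by (simp add: qpoch_def)

lemma qpoch_inf_antimono:
  assumes "x \<le> y" "y < 1"
  shows "qpoch_inf y q \<le> qpoch_inf x q"
proof (rule LIMSEQ_le[OF qpoch_tendsto qpoch_tendsto])
  show "\<exists>N. \<forall>n\<ge>N. qpoch y q n \<le> qpoch x q n"
    unfolding qpoch_def using assms q q_mult_less_1[OF assms(2)]
    by (intro exI[of _ 0] allI impI prod_mono) (auto intro!: mult_right_mono less_imp_le)
qed

text \<open>The shifted product is the full product divided by a partial product that converges to
  it.\<close>

lemma qpoch_inf_shift_tendsto: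
  assumes "x < 1"
  shows "(\<lambda>n. qpoch_inf (x * q ^ n) q) \<longlonglongrightarrow> 1"
proof -
  have "(\<lambda>n. qpoch_inf x q / qpoch x q n) \<longlonglongrightarrow> qpoch_inf x q / qpoch_inf x q"
    using qpoch_inf_pos[OF assms] by (intro tendsto_intros qpoch_tendsto) auto
  moreover have "qpoch_inf x q / qpoch x q n = qpoch_inf (x * q ^ n) q" for n
    using qpoch_pos[OF assms, of n] qpoch_inf_split[of x n] by simp
  ultimately show ?thesis
    using qpoch_inf_pos[OF assms] by simp
qed

lemma qpoch_inf_minus_pos: "x > 0 \<Longrightarrow> qpoch_inf (- x) q > 0"
  by (rule qpoch_inf_pos) simp

section \<open>Positivity, functional equations and summability of the kernel\<close>

lemma rat_kernel_nonneg: "a \<ge> 0 \<Longrightarrow> b \<ge> 0 \<Longrightarrow> t > 0 \<Longrightarrow> rat_kernel q a b t \<ge> 0"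
proof -
  assume *: "a \<ge> 0" "b \<ge> 0" "t > 0"
  then have "t * b \<ge> 0" "q * a / t \<ge> 0" "q / t > 0"
    using q by auto
  then have "- (t * b) < 1" "- (q * a / t) < 1" "- t < 1" "- (q / t) < 1"
    using * by linarith+
  with * show ?thesis
    unfolding rat_kernel_def
    by (intro divide_nonneg_nonneg mult_nonneg_nonneg less_imp_le[OF qpoch_inf_pos])
qed

lemma rat_kernel_mono:
  assumes "0 \<le> a" "a \<le> a'" "0 \<le> b" "b \<le> b'" "t > 0"
  shows "rat_kernel q a b t \<le> rat_kernel q a' b' t"
proof -
  have "- (t * b) \<le> 0" "- (q * a / t) \<le> 0" "- (t * b') \<le> 0" "- (q * a' / t) \<le> 0"
    using assms q by auto
  then have "- (t * b) < 1" "- (q * a / t) < 1" "- (t * b') < 1" "- (q * a' / t) < 1"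
    by linarith+
  then show ?thesis
    unfolding rat_kernel_def using assms q
    by (intro divide_right_mono mult_mono qpoch_inf_antimono mult_nonneg_nonneg
        less_imp_le[OF qpoch_inf_pos] less_imp_le[OF qpoch_inf_minus_pos])
       (auto intro!: divide_right_mono mult_left_mono)
qed

text \<open>The substitution interchanges the two factors of the denominator and the roles of
  \<open>a\<close> and \<open>b\<close> in the numerator. It transfers every result about
  \<open>b\<close> to \<open>a\<close>.\<close>

lemma rat_kernel_swap: "t > 0 \<Longrightarrow> rat_kernel q a b (q / t) = rat_kernel q b a t"
  unfolding rat_kernel_def using q by (simp add: field_simps)

lemma rat_kernel_mult:
  "(1 + t * b) * rat_kernel q a (b * q) t = rat_kernel q a b t"
  using qpoch_inf_step[of "- (t * b)"] by (simp add: rat_kernel_def mult.assoc)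

text \<open>Both sides have the same numerator. The factor t comes from the denominator, a theta
  function that is divided by t when t becomes qt.\<close>

lemma rat_kernel_shift:
  assumes "t > 0"
  shows "rat_kernel q (a * q) b (q * t) = t * rat_kernel q a (b * q) t"
proof -
  have "qpoch_inf (- (q * t)) q > 0" "qpoch_inf (- (q / t)) q > 0"
    using assms q by (auto intro: qpoch_inf_minus_pos)
  moreover have "qpoch_inf (- t) q = (1 + t) * qpoch_inf (- (q * t)) q"
    using qpoch_inf_step[of "- t"] by (simp add: mult.commute)
  moreover have "qpoch_inf (- (1 / t)) q = (1 + 1 / t) * qpoch_inf (- (q / t)) q"
    using qpoch_inf_step[of "- (1 / t)"] by (simp add: mult.commute)
  moreover have "q / (q * t) = 1 / t" "q * (a * q) / (q * t) = q * a / t" "q * t * b = t * (b * q)"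
    using q assms by auto
  moreover have "1 + 1 / t = (1 + t) / t" "1 + t > 0"
    using assms by (auto simp: field_simps)
  ultimately show ?thesis
    unfolding rat_kernel_def by (simp only:) (use assms in \<open>simp add: field_simps\<close>)
qed

lemma rat_kernel_mult':
  "(1 + q * a / t) * rat_kernel q (a * q) b t = rat_kernel q a b t"
  using qpoch_inf_step[of "- (q * a / t)"] by (simp add: rat_kernel_def mult.assoc)

lemma rat_kernel_scale:
  assumes "t > 0"
  shows "rat_kernel q a b (q * t) = (t + a) * rat_kernel q a (b * q) t"
proof -
  have "rat_kernel q a b (q * t) = (1 + a / t) * rat_kernel q (a * q) b (q * t)"
    using rat_kernel_mult'[of a "q * t" b] assms q by simp
  then show ?thesis
    using assms by (simp add: rat_kernel_shift distrib_right)
qed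

text \<open>By \<open>rat_kernel_scale\<close> and monotonicity, the ratio of consecutive terms is
  at most t + a, which tends to a < 1. The midpoint (1 + a) / 2 serves as the bound in the ratio
  test.\<close>

lemma rat_kernel_summable_nat:
  assumes "0 < a" "a < 1" "0 < b" "s > 0"
  shows "summable (\<lambda>n. rat_kernel q a b (s * q ^ n))"
proof -
  have "(\<lambda>n. s * q ^ n) \<longlonglongrightarrow> s * 0"
    using q by (intro tendsto_intros LIMSEQ_power_zero) auto
  then have "eventually (\<lambda>n. s * q ^ n < (1 - a) / 2) sequentially"
    by (rule order_tendstoD(2)) (use assms in auto)
  then obtain N where N: "\<And>n. n \<ge> N \<Longrightarrow> s * q ^ n < (1 - a) / 2"
    by (auto simp: eventually_at_top_linorder)
  show ?thesis
  proof (rule summable_ratio_test[of "(1 + a) / 2" N])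
    fix n assume "n \<ge> N"
    define t where "t = s * q ^ n"
    have t: "t > 0" "t + a \<le> (1 + a) / 2"
      using assms q N[OF \<open>n \<ge> N\<close>] by (auto simp: t_def field_simps)
    have "rat_kernel q a b (q * t) = (t + a) * rat_kernel q a (b * q) t"
      using t assms by (intro rat_kernel_scale) auto
    also have "\<dots> \<le> (1 + a) / 2 * rat_kernel q a b t"
      using t assms q by (intro mult_mono rat_kernel_mono rat_kernel_nonneg) (auto simp: mult_left_le)
    finally have *: "rat_kernel q a b (q * t) \<le> (1 + a) / 2 * rat_kernel q a b t" .
    have "rat_kernel q a b (q * t) \<ge> 0" "rat_kernel q a b t \<ge> 0"
      using t assms q by (auto intro!: rat_kernel_nonneg)
    with * show "norm (rat_kernel q a b (s * q ^ Suc n)) \<le> (1 + a) / 2 * norm (rat_kernel q a b (s * q ^ n))"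
      by (simp add: t_def mult_ac)
  qed (use assms in auto)
qed

lemma rat_kernel_summable:
  assumes "0 < a" "a < 1" "0 < b" "b < 1" "s > 0"
  shows "(\<lambda>k::int. rat_kernel q a b (s * q powi k)) summable_on UNIV"
proof -
  \<comment> \<open>Under t -> q/t the point of index -n-1 goes to q^(n+2) / s, which explains the
    starting point \<open>q * q / s\<close>.\<close>
  have "rat_kernel q b a ((q * q / s) * q ^ n) = rat_kernel q a b (s * q powi (- int n - 1))" for n
  proof -
    have "q powi (- int n - 1) = 1 / (q ^ n * q)"
      using q by (simp add: power_int_diff power_int_minus field_simps)
    then have "(q * q / s) * q ^ n = q / (s * q powi (- int n - 1))" 
      using assms q by (simp add: field_simps)
    then show ?thesis using assms q by (simp only:) (intro rat_kernel_swap, simp)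
  qed
  then have "summable (\<lambda>n. rat_kernel q a b (s * q powi (- int n - 1)))"
    using rat_kernel_summable_nat[of b a "q * q / s"] assms q by simp
  moreover have "summable (\<lambda>n. rat_kernel q a b (s * q powi int n))"
    using rat_kernel_summable_nat[of a b s] assms by simp
  ultimately have "((\<lambda>k. rat_kernel q a b (s * q powi k)) has_sum
      ((\<Sum>n. rat_kernel q a b (s * q powi int n)) + (\<Sum>n. rat_kernel q a b (s * q powi (- int n - 1))))) UNIV"
    using assms q by (intro has_sum_int_nonneg rat_kernel_nonneg summable_sums) auto
  then show ?thesis
    by (rule has_sum_imp_summable)
qed

section \<open>Ramanujan's bilateral sum\<close>

text \<open>Let T be the sum of t times the kernel for (a, bq). Then \<open>rat_kernel_mult\<close>
  gives F - U = bT, and \<open>rat_kernel_scale\<close> gives F = T + aU; eliminating T yields the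
  claim.\<close>

lemma rat_kernel_infsum_step:
  assumes "0 < a" "a < 1" "0 < b" "b < 1" "s > 0"
  shows "(\<Sum>\<^sub>\<infinity>k::int. rat_kernel q a b (s * q powi k)) =
    (1 - a * b) / (1 - b) * (\<Sum>\<^sub>\<infinity>k::int. rat_kernel q a (b * q) (s * q powi k))"
proof -
  define F where "F = (\<Sum>\<^sub>\<infinity>k::int. rat_kernel q a b (s * q powi k))"
  define U where "U = (\<Sum>\<^sub>\<infinity>k::int. rat_kernel q a (b * q) (s * q powi k))"
  have t: "s * q powi k > 0" for k using assms q by simp
  have bq: "b * q > 0" "b * q < 1" using assms q q_mult_less_1[of b 1] by auto
  have F: "((\<lambda>k::int. rat_kernel q a b (s * q powi k)) has_sum F) UNIV"
    unfolding F_def using assms by (intro has_sum_infsum rat_kernel_summable)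
  have U: "((\<lambda>k::int. rat_kernel q a (b * q) (s * q powi k)) has_sum U) UNIV"
    unfolding U_def using assms bq by (intro has_sum_infsum rat_kernel_summable)
  have "((\<lambda>k::int. rat_kernel q a b (s * q powi k) - rat_kernel q a (b * q) (s * q powi k))
      has_sum (F - U)) UNIV"
    using has_sum_add[OF F has_sum_cmult_right[OF U, of "- 1"]] by simp
  moreover have "rat_kernel q a b (s * q powi k) - rat_kernel q a (b * q) (s * q powi k)
      = b * ((s * q powi k) * rat_kernel q a (b * q) (s * q powi k))" for k
    using rat_kernel_mult[of "s * q powi k" b a] t assms by (simp add: algebra_simps)
  ultimately have "((\<lambda>k::int. b * ((s * q powi k) * rat_kernel q a (b * q) (s * q powi k)))
      has_sum (F - U)) UNIV"
    by simp
  then have T: "((\<lambda>k::int. (s * q powi k) * rat_kernel q a (b * q) (s * q powi k))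
      has_sum ((F - U) / b)) UNIV"
    using assms by (subst (asm) has_sum_cmult_right_iff) auto
  \<comment> \<open>The lattice is invariant under t -> qt, so this index shift does not change the
    bilateral sum.\<close>
  have "((\<lambda>k::int. rat_kernel q a b (s * q powi (k + 1))) has_sum F) UNIV"
    using has_sum_reindex_bij_betw[of "\<lambda>k::int. k + 1" UNIV UNIV 
        "\<lambda>k. rat_kernel q a b (s * q powi k)" F] F
    by (simp add: bij_plus_right)
  moreover have "rat_kernel q a b (s * q powi (k + 1)) =
      (s * q powi k) * rat_kernel q a (b * q) (s * q powi k)
      + a * rat_kernel q a (b * q) (s * q powi k)" for k
  proof -
    have "s * q powi (k + 1) = q * (s * q powi k)"
      using q by (simp add: power_int_add_1)
    then show ?thesis 
      using rat_kernel_scale[of "s * q powi k" a b] t assms by (simp only: distrib_right)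
  qed
  ultimately have "((\<lambda>k::int. (s * q powi k) * rat_kernel q a (b * q) (s * q powi k)
      + a * rat_kernel q a (b * q) (s * q powi k)) has_sum F) UNIV"
    by simp
  moreover have "((\<lambda>k::int. (s * q powi k) * rat_kernel q a (b * q) (s * q powi k)
      + a * rat_kernel q a (b * q) (s * q powi k)) has_sum ((F - U) / b + a * U)) UNIV"
    by (intro has_sum_add has_sum_cmult_right T U)
  ultimately have "F = (F - U) / b + a * U"
    by (rule has_sum_unique)
  then have "F * (1 - b) = U * (1 - a * b)"
    using assms by (simp add: field_simps)
  then show ?thesis
    using assms unfolding F_def[symmetric] U_def[symmetric] by (simp add: field_simps)
qed


text \<open>The map t -> q/t carries the lattice through \<open>s\<close> to the one through
  \<open>1 / s\<close>, with index k becoming 1 - k.\<close>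

lemma rat_kernel_has_sum_swap:
  assumes "s > 0"
  shows "((\<lambda>k::int. rat_kernel q a b (s * q powi k)) has_sum x) UNIV \<longleftrightarrow>
    ((\<lambda>k::int. rat_kernel q b a (1 / s * q powi k)) has_sum x) UNIV"
proof -
  have bij: "bij (\<lambda>k::int. 1 - k)"
    by (rule bij_betw_byWitness[where f' = "\<lambda>k. 1 - k"]) auto
  have "rat_kernel q b a (1 / s * q powi (1 - k)) = rat_kernel q a b (s * q powi k)" for k
  proof -
    have "1 / s * q powi (1 - k) = q / (s * q powi k)"
      using q by (simp add: power_int_diff)
    then show ?thesis
      using assms q by (simp only:) (intro rat_kernel_swap, simp)
  qed
  then show ?thesis
    using has_sum_reindex_bij_betw[OF bij, of "\<lambda>k. rat_kernel q b a (1 / s * q powi k)" x] by simp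
qed

section \<open>Evaluation of the bilateral sum through the quotient by its expected value\<close>

text \<open>Multiplied by (1 - q) and \<open>qpoch_inf q q\<close>, this is the q-beta function for
  a = q^(alpha+1) and b = q^(beta+1). Without these constants it tends to 1 along the parameter
  shifts.\<close>

definition qbeta :: "real \<Rightarrow> real \<Rightarrow> real" where
  "qbeta a b = qpoch_inf (a * b) q / (qpoch_inf a q * qpoch_inf b q)"

lemma qbeta_pos: "0 < a \<Longrightarrow> a < 1 \<Longrightarrow> 0 < b \<Longrightarrow> b < 1 \<Longrightarrow> qbeta a b > 0"
  unfolding qbeta_def by (intro divide_pos_pos mult_pos_pos qpoch_inf_pos) (auto simp: mult_less_1)

lemma qbeta_step:
  assumes "0 < a" "a < 1" "0 < b" "b < 1"
  shows "qbeta a b = (1 - a * b) / (1 - b) * qbeta a (b * q)"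
  using assms qpoch_inf_step[of "a * b"] qpoch_inf_step[of b]
  by (simp add: qbeta_def mult_ac)

text \<open>Here \<open>x\<close> is the quotient of the bilateral sum by \<open>qbeta\<close>. Both
  satisfy the same recursion in \<open>b\<close> with a nonzero factor, so \<open>x\<close> is
  preserved.\<close>

lemma rat_kernel_has_sum_step:
  assumes "0 < a" "a < 1" "0 < b" "b < 1" "s > 0"
    and "((\<lambda>k::int. rat_kernel q a b (s * q powi k)) has_sum qbeta a b * x) UNIV"
  shows "((\<lambda>k::int. rat_kernel q a (b * q) (s * q powi k)) has_sum qbeta a (b * q) * x) UNIV"
proof -
  define U where "U = (\<Sum>\<^sub>\<infinity>k::int. rat_kernel q a (b * q) (s * q powi k))"
  have "b * q > 0" "b * q < 1" using assms q q_mult_less_1[of b 1] by auto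
  then have "((\<lambda>k::int. rat_kernel q a (b * q) (s * q powi k)) has_sum U) UNIV"
    unfolding U_def using assms by (intro has_sum_infsum rat_kernel_summable)
  moreover have "a * b < 1" using assms by (simp add: mult_less_1)
  moreover have "qbeta a b * x = (1 - a * b) / (1 - b) * U"
    using rat_kernel_infsum_step[OF assms(1-5)] assms(6) by (simp add: infsumI U_def)
  then have "(1 - a * b) / (1 - b) * (qbeta a (b * q) * x) = (1 - a * b) / (1 - b) * U"
    using assms by (simp add: qbeta_step)
  ultimately show ?thesis using assms by simp
qed

lemma rat_kernel_has_sum_step':
  assumes "0 < a" "a < 1" "0 < b" "b < 1" "s > 0"
    and "((\<lambda>k::int. rat_kernel q a b (s * q powi k)) has_sum qbeta a b * x) UNIV"
  shows "((\<lambda>k::int. rat_kernel q (a * q) b (s * q powi k)) has_sum qbeta (a * q) b * x) UNIV"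
proof -
  have comm: "qbeta c d = qbeta d c" for c d
    by (simp add: qbeta_def mult.commute)
  have "((\<lambda>k::int. rat_kernel q b a (1 / s * q powi k)) has_sum qbeta b a * x) UNIV"
    using assms by (subst rat_kernel_has_sum_swap[symmetric]) (simp_all add: comm)
  then have "((\<lambda>k::int. rat_kernel q b (a * q) (1 / s * q powi k)) has_sum qbeta b (a * q) * x) UNIV"
    using assms by (intro rat_kernel_has_sum_step) auto
  then show ?thesis
    using assms by (subst rat_kernel_has_sum_swap) (simp_all add: comm)
qed

lemma rat_kernel_has_sum_shift:
  assumes "0 < a" "a < 1" "0 < b" "b < 1" "s > 0"
    and "((\<lambda>k::int. rat_kernel q a b (s * q powi k)) has_sum qbeta a b * x) UNIV"
  shows "((\<lambda>k::int. rat_kernel q (a * q ^ n) (b * q ^ n) (s * q powi k))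
    has_sum qbeta (a * q ^ n) (b * q ^ n) * x) UNIV"
proof (induction n)
  case 0
  then show ?case using assms by simp
next
  case (Suc n)
  have 1: "0 < c * q ^ n" "c * q ^ n < 1" "0 < c * q ^ n * q" "c * q ^ n * q < 1"
    if "0 < c" "c < 1" for c
    using that q q_mult_less_1[of c n] q_mult_less_1[of c "Suc n"] by (auto simp: mult_ac)
  have "((\<lambda>k::int. rat_kernel q (a * q ^ n * q) (b * q ^ n * q) (s * q powi k))
    has_sum qbeta (a * q ^ n * q) (b * q ^ n * q) * x) UNIV"
    using assms 1[of a] 1[of b] Suc.IH
    by (intro rat_kernel_has_sum_step rat_kernel_has_sum_step') auto
  then show ?case by (simp add: mult_ac)
qed

lemma qbeta_shift_tendsto:
  assumes "0 < a" "a < 1" "0 < b" "b < 1"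
  shows "(\<lambda>n. qbeta (a * q ^ n) (b * q ^ n)) \<longlonglongrightarrow> 1"
proof -
  have "(\<lambda>n. qpoch_inf (a * b * q ^ (2 * n)) q) \<longlonglongrightarrow> 1"
    using LIMSEQ_subseq_LIMSEQ[OF qpoch_inf_shift_tendsto[of "a * b"], of "\<lambda>n. 2 * n"] assms
    by (simp add: mult_less_1 strict_mono_def o_def)
  moreover have "(a * q ^ n) * (b * q ^ n) = a * b * q ^ (2 * n)" for n
    by (simp add: mult_2 power_add)
  ultimately have "(\<lambda>n. qbeta (a * q ^ n) (b * q ^ n)) \<longlonglongrightarrow> 1 / (1 * 1)"
    unfolding qbeta_def using assms by (simp only:) (intro tendsto_intros qpoch_inf_shift_tendsto; simp)
  then show ?thesis by simp
qed

text \<open>For fixed l, the parameters a q^n and b q^n eventually lie below a' q^l and b' q^l, so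
  monotonicity compares the sums. Letting n and then l tend to infinity removes the
  \<open>qbeta\<close> factors. Used in both directions, this shows that the quotient does not
  depend on the parameters.\<close>

lemma rat_kernel_constant_le:
  assumes "0 < a" "a < 1" "0 < b" "b < 1" "0 < a'" "a' < 1" "0 < b'" "b' < 1" "s > 0"
    and x: "((\<lambda>k::int. rat_kernel q a b (s * q powi k)) has_sum qbeta a b * x) UNIV"
    and y: "((\<lambda>k::int. rat_kernel q a' b' (s * q powi k)) has_sum qbeta a' b' * y) UNIV"
  shows "x \<le> y"
proof -
  let ?x = "\<lambda>n. qbeta (a * q ^ n) (b * q ^ n) * x"
  let ?y = "\<lambda>n. qbeta (a' * q ^ n) (b' * q ^ n) * y"
  have lim_x: "?x \<longlonglongrightarrow> 1 * x" and lim_y: "?y \<longlonglongrightarrow> 1 * y"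
    using assms by (intro tendsto_intros qbeta_shift_tendsto; simp)+
  have "x \<le> ?y l" for l
  proof -
    have "(\<lambda>n. c * q ^ n) \<longlonglongrightarrow> 0" for c
      using q by (intro tendsto_mult_right_zero LIMSEQ_power_zero) auto
    then have "eventually (\<lambda>n. c * q ^ n < d) sequentially" if "d > 0" for c d
      using that by (rule order_tendstoD(2))
    then have "eventually (\<lambda>n. a * q ^ n < a' * q ^ l) sequentially"
      "eventually (\<lambda>n. b * q ^ n < b' * q ^ l) sequentially"
      using assms q by auto
    then have "eventually (\<lambda>n. ?x n \<le> ?y l) sequentially"
    proof eventually_elim
      case (elim n)
      then show ?case
        using assms q
        by (intro has_sum_mono[OF rat_kernel_has_sum_shift[OF assms(1-4,9) x, of n]
              rat_kernel_has_sum_shift[OF assms(5-8,9) y, of l]] rat_kernel_mono) auto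
    qed
    then show ?thesis
      using tendsto_upperbound[OF lim_x] by simp
  qed
  then have "x \<le> 1 * y"
    by (intro tendsto_lowerbound[OF lim_y]) auto
  then show ?thesis by simp
qed

text \<open>For a = b = q the infinite products cancel down to two linear factors. In the partial
  fractions, t/q is the preceding lattice point, which prepares the telescoping.\<close>

lemma rat_kernel_q_q:
  assumes "t > 0"
  shows "rat_kernel q q q t = (1 / (1 + t) - 1 / (1 + t / q)) / (1 - q)"
proof -
  have "qpoch_inf (- (t * q)) q > 0" "qpoch_inf (- (q * q / t)) q > 0"
    using q assms by (auto intro: qpoch_inf_minus_pos)
  then have "rat_kernel q q q t = 1 / ((1 + t) * (1 + q / t))"
    using qpoch_inf_step[of "- t"] qpoch_inf_step[of "- (q / t)"]
    by (simp add: rat_kernel_def mult_ac)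
  also have "\<dots> = (1 / (1 + t) - 1 / (1 + t / q)) / (1 - q)"
  proof -
    have "1 + t > 0" "t + q > 0" "1 - q > 0" using assms q by auto
    moreover from this have "1 + q / t = (t + q) / t" "1 + t / q = (t + q) / q"
      using assms q by (auto simp: field_simps)
    ultimately show ?thesis 
      using assms q by (simp add: divide_simps) (simp add: algebra_simps)
  qed
  finally show ?thesis .
qed

lemma rat_kernel_has_sum_q_q:
  assumes "s > 0"
  shows "((\<lambda>k::int. rat_kernel q q q (s * q powi k)) has_sum (1 / (1 - q))) UNIV"
proof -
  define f where "f k = 1 / (1 + s * q powi k) / (1 - q)" for k :: int
  have eq: "rat_kernel q q q (s * q powi k) = f k - f (k - 1)" for k
    using rat_kernel_q_q[of "s * q powi k"] assms q
    by (simp add: f_def power_int_diff diff_divide_distrib)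
  have "(\<lambda>n. q ^ n) \<longlonglongrightarrow> 0"
    using q by (intro LIMSEQ_power_zero) auto
  then have "(\<lambda>n. 1 / (1 + s * q ^ n) / (1 - q)) \<longlonglongrightarrow> 1 / (1 + s * 0) / (1 - q)"
    using q by (intro tendsto_intros) auto
  then have "(\<lambda>n. f (int n - 1)) \<longlonglongrightarrow> 1 / (1 - q)"
    using LIMSEQ_offset[of "\<lambda>n. f (int n - 1)" 1] by (simp add: f_def)
  from telescope_sums[OF this]
  have 1: "(\<lambda>n. f (int n) - f (int n - 1)) sums (1 / (1 - q) - f (- 1))"
    by simp
  have "(\<lambda>n. q ^ n / (q ^ n + s) / (1 - q)) \<longlonglongrightarrow> 0 / (0 + s) / (1 - q)"
    using q assms \<open>(\<lambda>n. q ^ n) \<longlonglongrightarrow> 0\<close> by (intro tendsto_intros) auto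
  moreover have "q ^ n / (q ^ n + s) / (1 - q) = f (- int n)" for n
  proof -
    have "q ^ n > 0" "q ^ n + s > 0" using q assms by (auto intro: add_pos_pos)
    then show ?thesis
      using q by (simp add: f_def power_int_minus divide_simps add.commute)
  qed
  ultimately have "(\<lambda>n. f (- int n)) \<longlonglongrightarrow> 0"
    by simp
  moreover have "f (- int n - 1) = f (- int (Suc n))" for n
    by (rule arg_cong[of _ _ f]) simp
  ultimately have "(\<lambda>n. f (- int n - 1)) \<longlonglongrightarrow> 0"
    using LIMSEQ_Suc[of "\<lambda>n. f (- int n)" 0] by simp
  from telescope_sums'[OF this]
  have 2: "(\<lambda>n. f (- int n - 1) - f (- int n - 1 - 1)) sums (f (- 1) - 0)"
    by (simp add: algebra_simps)
  \<comment> \<open>The two halves telescope separately; \<open>f\<close> has limit 1/(1-q) at plus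
    infinity and 0 at minus infinity, and the boundary value at index -1 cancels.\<close>
  have "((\<lambda>k. rat_kernel q q q (s * q powi k)) has_sum ((1 / (1 - q) - f (- 1)) + (f (- 1) - 0))) UNIV"
    using assms q
    by (intro has_sum_int_nonneg rat_kernel_nonneg) (auto simp only: eq 1 2, auto)
  then show ?thesis by simp
qed

lemma rat_kernel_has_sum:
  assumes "0 < a" "a < 1" "0 < b" "b < 1" "s > 0"
  shows "((\<lambda>k::int. rat_kernel q a b (s * q powi k)) has_sum
    (qpoch_inf q q * qpoch_inf (a * b) q / (qpoch_inf a q * qpoch_inf b q))) UNIV"
proof -
  define x where "x = (\<Sum>\<^sub>\<infinity>k::int. rat_kernel q a b (s * q powi k)) / qbeta a b"
  have "((\<lambda>k::int. rat_kernel q a b (s * q powi k)) has_sum (qbeta a b * x)) UNIV"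
    using has_sum_infsum[OF rat_kernel_summable[OF assms]] qbeta_pos[of a b] assms
    by (simp add: x_def)
  \<comment> \<open>The known sum at a = b = q is put in the form \<open>qbeta\<close> times a
    constant, which identifies that constant as \<open>qpoch_inf q q\<close>.\<close>
  moreover have "qbeta q q * qpoch_inf q q = 1 / (1 - q)"
    using qpoch_inf_step[of q] qpoch_inf_pos[of q] q_mult_less_1[of q 1] qpoch_inf_pos[of "q * q"] q
    by (simp add: qbeta_def field_simps)
  then have "((\<lambda>k::int. rat_kernel q q q (s * q powi k)) has_sum (qbeta q q * qpoch_inf q q)) UNIV"
    using rat_kernel_has_sum_q_q[OF assms(5)] by simp
  ultimately have "x = qpoch_inf q q"
    using assms q by (intro antisym) (auto elim!: rat_kernel_constant_le[rotated -2])
  with \<open>((\<lambda>k::int. rat_kernel q a b (s * q powi k)) has_sum (qbeta a b * x)) UNIV\<close>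
  show ?thesis by (simp add: qbeta_def mult_ac)
qed


section \<open>The \<open>q\<close>-Chu-Vandermonde sum and the double sum\<close>

text \<open>
  The quotient \<open>(\<Prod>i<j. q ^ n - q ^ i) / qpoch q q j\<close> is the Gaussian binomial coefficient
  times \<open>(- 1) ^ j * q ^ (j * (j - 1) div 2)\<close>, and this is its Pascal rule.
\<close>

lemma qbinomial_Suc_Suc:
  "(\<Prod>i<Suc j. q ^ Suc n - q ^ i) / qpoch q q (Suc j) =
    (\<Prod>i<Suc j. q ^ n - q ^ i) / qpoch q q (Suc j) - q ^ n * ((\<Prod>i<j. q ^ n - q ^ i) / qpoch q q j)"
proof -
  have "(\<Prod>i<Suc j. q ^ Suc n - q ^ i) = (q ^ Suc n - 1) * (\<Prod>i<j. q * (q ^ n - q ^ i))"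
    by (simp add: prod.lessThan_Suc_shift right_diff_distrib del: prod.lessThan_Suc)
  also have "\<dots> = (q ^ Suc n - 1) * q ^ j * (\<Prod>i<j. q ^ n - q ^ i)"
    by (simp add: prod.distrib)
  finally have "(\<Prod>i<Suc j. q ^ Suc n - q ^ i) = 
    (\<Prod>i<Suc j. q ^ n - q ^ i) - (1 - q * q ^ j) * q ^ n * (\<Prod>i<j. q ^ n - q ^ i)"
    by (simp add: algebra_simps)
  moreover have "qpoch q q j > 0" "1 - q * q ^ j > 0"
    using q qpoch_pos q_mult_less_1[of q j] by auto
  ultimately show ?thesis
    by (simp add: qpoch_Suc diff_divide_distrib)
qed

text \<open>Induction on n with \<open>b\<close> arbitrary: the Pascal rule splits the sum for n + 1
  into the sum for n and a multiple of the sum for n with \<open>b * q\<close>. The product of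
  differences stands for the factorial of q^(-n) times q^(nj).\<close>

lemma q_chu_vandermonde:
  assumes "\<And>i. i < n \<Longrightarrow> b * x * q ^ i \<noteq> 1"
  shows "(\<Sum>j\<le>n. (\<Prod>i<j. q ^ n - q ^ i) / qpoch q q j * (qpoch b q j / qpoch (b * x) q j * x ^ j))
    = qpoch x q n / qpoch (b * x) q n"
  using assms
proof (induction n arbitrary: b)
  case 0
  then show ?case by simp
next
  case (Suc n)
  define c where "c n j = (\<Prod>i<j. q ^ n - q ^ i) / qpoch q q j" for n j
  define T where "T b j = qpoch b q j / qpoch (b * x) q j * x ^ j" for b j
  have T_Suc: "T b (Suc j) = x * (1 - b) / (1 - b * x) * T (b * q) j" for j
    by (simp add: T_def qpoch_Suc' mult_ac)
  \<comment> \<open>The factor i = n vanishes, so the sum shifted by one index may still run up to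
    n.\<close>
  have "c n (Suc n) = 0"
    by (simp add: c_def)
  then have 1: "(\<Sum>j\<le>n. c n (Suc j) * T b (Suc j)) + T b 0 = (\<Sum>j\<le>n. c n j * T b j)"
    using sum.atMost_Suc_shift[of "\<lambda>j. c n j * T b j" n] by (simp add: c_def)
  have "(\<Sum>j\<le>Suc n. c (Suc n) j * T b j) = T b 0 + (\<Sum>j\<le>n. c (Suc n) (Suc j) * T b (Suc j))"
    by (subst sum.atMost_Suc_shift) (simp add: c_def)
  also have "\<dots> = T b 0 + (\<Sum>j\<le>n. c n (Suc j) * T b (Suc j) - q ^ n * c n j * T b (Suc j))"
    unfolding c_def qbinomial_Suc_Suc by (simp add: left_diff_distrib mult.assoc)
  also have "\<dots> = (\<Sum>j\<le>n. c n j * T b j) - q ^ n * (x * (1 - b) / (1 - b * x)) * (\<Sum>j\<le>n. c n j * T (b * q) j)"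
    unfolding 1[symmetric] by (simp add: sum_subtractf T_Suc sum_distrib_left sum_divide_distrib mult_ac)
  also have "(\<Sum>j\<le>n. c n j * T b j) = qpoch x q n / qpoch (b * x) q n"
    unfolding c_def T_def using Suc.prems by (intro Suc.IH) auto
  also have "(\<Sum>j\<le>n. c n j * T (b * q) j) = qpoch x q n / qpoch (b * q * x) q n"
    unfolding c_def T_def using Suc.prems[of "Suc i" for i] by (intro Suc.IH) (auto simp: mult_ac)
  also have "qpoch x q n / qpoch (b * x) q n
      - q ^ n * (x * (1 - b) / (1 - b * x)) * (qpoch x q n / qpoch (b * q * x) q n)
    = qpoch x q (Suc n) / qpoch (b * x) q (Suc n)"
  proof -
    \<comment> \<open>A common denominator: splitting off its first or its last factor gives the two
      denominators that occur.\<close>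
    define W where "W = qpoch (b * x) q (Suc n)"
    have W: "W = (1 - b * x) * qpoch (b * q * x) q n" "W = qpoch (b * x) q n * (1 - b * x * q ^ n)"
      unfolding W_def by (simp add: qpoch_Suc' mult_ac) (simp add: qpoch_Suc)
    have nz: "1 - b * x * q ^ n \<noteq> 0"
      using Suc.prems[of n] by simp
    have 1: "q ^ n * (x * (1 - b) / (1 - b * x)) * (qpoch x q n / qpoch (b * q * x) q n)
      = q ^ n * x * (1 - b) * qpoch x q n / W"
      by (simp add: W(1) mult_ac)
    have 2: "qpoch x q n / qpoch (b * x) q n = qpoch x q n * (1 - b * x * q ^ n) / W"
      using nz by (simp add: W(2))
    show ?thesis
      unfolding W_def[symmetric] 1 2 qpoch_Suc[of x] diff_divide_distrib[symmetric]
      by (simp add: algebra_simps)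
  qed
  finally show ?case
    unfolding c_def T_def .
qed

section \<open>Orthogonality of the double sum of coefficients\<close>

text \<open>This is the part of the series coefficient that involves \<open>a\<close> and
  \<open>b\<close> only through c = ab; hence it serves both rational functions, in spite of their
  exchanged parameters.\<close>

definition jacobi_coeff :: "real \<Rightarrow> nat \<Rightarrow> nat \<Rightarrow> real" where
  "jacobi_coeff c n j = qpoch (1 / q ^ n) q j * qpoch (c * q ^ n / q) q j / qpoch q q j * q ^ j"

lemma jacobi_coeff_sum:
  assumes "c < 1"
  shows "(\<Sum>j\<le>n. jacobi_coeff c n j * q ^ (j * k) / qpoch c q (j + k))
    = qpoch (q ^ Suc k / q ^ n) q n / qpoch c q (n + k)"
proof -
  \<comment> \<open>With upper parameter c q^(n-1), this choice makes the lower parameter c q^k, as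
    needed after splitting \<open>qpoch c q (j + k)\<close> at k.\<close>
  define x where "x = q ^ Suc k / q ^ n"
  have bx: "c * q ^ n / q * x = c * q ^ k"
    using q by (simp add: x_def)
  have "qpoch (1 / q ^ n) q j = (\<Prod>i<j. q ^ n - q ^ i) / q ^ (n * j)" for j
  proof -
    have "qpoch (1 / q ^ n) q j = (\<Prod>i<j. (q ^ n - q ^ i) / q ^ n)"
      unfolding qpoch_def using q by (intro prod.cong) (auto simp: diff_divide_distrib)
    then show ?thesis by (simp add: prod_dividef power_mult)
  qed
  moreover have "x ^ j = q ^ (j * k) * q ^ j / q ^ (n * j)" for j
    by (simp add: x_def power_divide power_mult_distrib power_mult[symmetric] mult_ac)
  ultimately have "jacobi_coeff c n j * q ^ (j * k) / qpoch c q (j + k) =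
    (\<Prod>i<j. q ^ n - q ^ i) / qpoch q q j *
      (qpoch (c * q ^ n / q) q j / qpoch (c * q ^ n / q * x) q j * x ^ j) / qpoch c q k" for j
    using qpoch_add[of c q k j] unfolding bx by (simp add: jacobi_coeff_def mult_ac add.commute)
  then have "(\<Sum>j\<le>n. jacobi_coeff c n j * q ^ (j * k) / qpoch c q (j + k)) =
    (\<Sum>j\<le>n. (\<Prod>i<j. q ^ n - q ^ i) / qpoch q q j *
      (qpoch (c * q ^ n / q) q j / qpoch (c * q ^ n / q * x) q j * x ^ j)) / qpoch c q k"
    by (simp add: sum_divide_distrib)
  also have "\<dots> = qpoch x q n / qpoch (c * q ^ n / q * x) q n / qpoch c q k"
  proof (subst q_chu_vandermonde)
    show "c * q ^ n / q * x * q ^ i \<noteq> 1" for i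
      unfolding bx using q_mult_less_1[OF assms, of "k + i"] by (simp add: power_add)
  qed simp
  also have "\<dots> = qpoch x q n / qpoch c q (n + k)"
    unfolding bx using qpoch_add[of c q k n] by (simp add: mult_ac add.commute)
  finally show ?thesis unfolding x_def .
qed

text \<open>The factor of index n - k - 1 vanishes.\<close>

lemma qpoch_eq_0: "k < n \<Longrightarrow> qpoch (q ^ Suc k / q ^ n) q n = 0"
  unfolding qpoch_def
  using q power_add[of q "Suc k" "n - Suc k"]
  by (intro prod_zero bexI[of _ "n - Suc k"]) (auto simp del: power_Suc)

lemma triangle_Suc: "Suc j * (Suc j - 1) div 2 = j * (j - 1) div 2 + j"
proof -
  have "Suc j * (Suc j - 1) = j * (j - 1) + j * 2"
    by (cases j) (auto simp: algebra_simps)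
  then show ?thesis by simp
qed

lemma qpoch_inverse_power: "qpoch (1 / q ^ n) q n * q ^ n = (- 1) ^ n * qpoch q q n / q ^ (n * (n - 1) div 2)"
proof (induction n)
  case 0
  then show ?case by simp
next
  case (Suc n)
  have "qpoch (1 / q ^ Suc n) q (Suc n) * q ^ Suc n
    = (1 - 1 / q ^ Suc n) * q ^ Suc n * (qpoch (1 / q ^ n) q n * q ^ n) / q ^ n"
    using q qpoch_Suc'[of "1 / q ^ Suc n" q n] by simp
  also have "(1 - 1 / q ^ Suc n) * q ^ Suc n = - (1 - q * q ^ n)"
    using q by (simp add: field_simps)
  finally show ?case
    unfolding Suc.IH triangle_Suc
    by (simp add: qpoch_Suc power_add algebra_simps diff_divide_distrib)
qed

text \<open>After summation over j only k >= n survives. This gives zero for m < n, symmetry covers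
  n < m, and for n = m the single term k = n remains.\<close>

lemma jacobi_coeff_orthogonal:
  assumes "0 < c" "c < 1"
  shows "(\<Sum>j\<le>n. \<Sum>k\<le>m. jacobi_coeff c n j * jacobi_coeff c m k * q ^ (j * k) / qpoch c q (j + k)) =
    (- 1) ^ n * (if n = 0 then 1 else (1 - c * q ^ n / q) / (1 - c * q ^ (2 * n) / q))
      * qpoch q q n * (if n = m then 1 else 0) / (q ^ (n * (n - 1) div 2) * qpoch c q n)"
    (is "?S n m = ?R")
proof -
  have S: "?S n m = (\<Sum>k\<le>m. jacobi_coeff c m k * (qpoch (q ^ Suc k / q ^ n) q n / qpoch c q (n + k)))" for n m
    unfolding jacobi_coeff_sum[OF assms(2), symmetric]
    by (subst sum.swap) (simp add: sum_distrib_left mult_ac)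
  have less: "?S n m = 0" if "m < n" for n m
    unfolding S using that by (intro sum.neutral) (auto simp del: power_Suc simp: qpoch_eq_0)
  have "?S n m = ?S m n"
    by (subst sum.swap) (simp add: mult_ac add.commute)
  then have neq: "?S n m = 0" if "n \<noteq> m"
    using less[of n m] less[of m n] that by linarith
  show ?thesis
  proof (cases "n = m")
    case False
    then show ?thesis using neq by simp
  next
    case True
    have "(\<Sum>k\<le>n. jacobi_coeff c n k * (qpoch (q ^ Suc k / q ^ n) q n / qpoch c q (n + k))) =
      (\<Sum>k\<in>{n}. jacobi_coeff c n k * (qpoch (q ^ Suc k / q ^ n) q n / qpoch c q (n + k)))"
      by (intro sum.mono_neutral_right) (auto simp del: power_Suc simp: qpoch_eq_0)
    then have "?S n n = jacobi_coeff c n n * (qpoch q q n / qpoch c q (n + n))"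
      unfolding S using q by simp
    also have "\<dots> = (qpoch (1 / q ^ n) q n * q ^ n) * (qpoch (c * q ^ n / q) q n / qpoch c q (n + n))"
      using qpoch_pos[of q n] q by (simp add: jacobi_coeff_def)
    \<comment> \<open>The case n = 0 is separate because c/q may equal 1, making the quotient 0/0.
      For n > 0 the factors from c q^n up to c q^(2n-2) cancel.\<close>
    also have "qpoch (c * q ^ n / q) q n / qpoch c q (n + n) =
      (if n = 0 then 1 else (1 - c * q ^ n / q) / (1 - c * q ^ (2 * n) / q)) / qpoch c q n"
    proof (cases n)
      case (Suc l)
      have "qpoch (c * q ^ Suc l) q l > 0"
        using assms by (intro qpoch_pos q_mult_less_1)
      moreover have "qpoch (c * q ^ l) q (Suc l) = (1 - c * q ^ l) * qpoch (c * q ^ Suc l) q l"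
        by (simp add: qpoch_Suc' mult_ac)
      moreover have "qpoch c q (Suc l + Suc l) =
        qpoch c q (Suc l) * (qpoch (c * q ^ Suc l) q l * (1 - c * q ^ (2 * Suc l) / q))"
        unfolding qpoch_add[of c q "Suc l" "Suc l"] qpoch_Suc[of "c * q ^ Suc l"]
        using q by (simp add: power_add mult_2)
      moreover have "c * q ^ Suc l / q = c * q ^ l"
        using q by simp
      ultimately show ?thesis
        unfolding Suc by simp
    qed simp
    finally show ?thesis
      unfolding qpoch_inverse_power using True by simp
  qed
qed

section \<open>Termwise integration\<close>

text \<open>Iterating \<open>rat_kernel_shift\<close> collects the factors t, qt, ..., q^(j-1)
  t.\<close>

lemma rat_kernel_power:
  assumes "t > 0"
  shows "rat_kernel q (a * q ^ j) b (q ^ j * t) =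
    q ^ (j * (j - 1) div 2) * t ^ j * rat_kernel q a (b * q ^ j) t"
proof (induction j arbitrary: b)
  case 0
  then show ?case by simp
next
  case (Suc j)
  have "rat_kernel q (a * q ^ j * q) b (q * (q ^ j * t)) = q ^ j * t * rat_kernel q (a * q ^ j) (b * q) (q ^ j * t)"
    using assms q by (intro rat_kernel_shift) simp
  then show ?case
    unfolding triangle_Suc using Suc.IH[of "b * q"] by (simp add: power_add mult_ac)
qed

text \<open>\<open>rat_kernel_power\<close> is applied to t^j and, after the reflection t -> q/t, to
  the k-th power. The cross factor q^(jk) arises from rewriting q/t in terms of the shifted point
  \<open>u\<close>.\<close>

lemma rat_kernel_monomial:
  assumes "t > 0"
  shows "q ^ (j * (j - 1) div 2) * q ^ (k * (k - 1) div 2) *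
      (t ^ j * (q / t) ^ k * rat_kernel q (a * q ^ k) (b * q ^ j) t)
    = q ^ (j * k) * rat_kernel q (a * q ^ j) (b * q ^ k) (t * q ^ j / q ^ k)"
proof -
  define u where "u = q ^ j * t"
  have u: "u > 0" using assms q by (simp add: u_def)
  have "(q / t) ^ k = q ^ (j * k) * (q / u) ^ k"
    using q assms by (simp add: u_def power_divide power_mult_distrib power_mult)
  then have "q ^ (j * (j - 1) div 2) * q ^ (k * (k - 1) div 2) *
      (t ^ j * (q / t) ^ k * rat_kernel q (a * q ^ k) (b * q ^ j) t)
    = q ^ (j * k) * (q ^ (k * (k - 1) div 2) * (q / u) ^ k * rat_kernel q (a * q ^ k * q ^ j) b u)"
    unfolding u_def using rat_kernel_power[OF assms, of "a * q ^ k" j b] by (simp add: mult_ac)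
  also have "rat_kernel q (a * q ^ k * q ^ j) b u = rat_kernel q b (a * q ^ j * q ^ k) (q / u)"
    using u by (subst rat_kernel_swap) (simp_all add: mult_ac)
  also have "q ^ (k * (k - 1) div 2) * (q / u) ^ k * rat_kernel q b (a * q ^ j * q ^ k) (q / u)
    = rat_kernel q (b * q ^ k) (a * q ^ j) (q ^ k * (q / u))"
    using u q by (intro rat_kernel_power[symmetric]) simp
  also have "q ^ k * (q / u) = q / (u / q ^ k)"
    using u by simp
  also have "rat_kernel q (b * q ^ k) (a * q ^ j) (q / (u / q ^ k)) =
    rat_kernel q (a * q ^ j) (b * q ^ k) (u / q ^ k)"
    using u q by (intro rat_kernel_swap) simp
  finally show ?thesis
    by (simp add: u_def mult.commute)
qed

text \<open>The denominators are initial segments of the two infinite products in the numerator of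
  the kernel.\<close>

lemma rat_kernel_qpoch:
  assumes "t > 0" "a > 0" "b > 0"
  shows "rat_kernel q a b t / (qpoch (- (t * b)) q j * qpoch (- (q * a / t)) q k)
    = rat_kernel q (a * q ^ k) (b * q ^ j) t"
proof -
  have "t * b > 0" "q * a / t > 0" using assms q by auto
  then have "qpoch (- (t * b)) q j > 0" "qpoch (- (q * a / t)) q k > 0"
    by (auto intro!: qpoch_pos)
  then show ?thesis
    using qpoch_inf_split[of "- (t * b)" j] qpoch_inf_split[of "- (q * a / t)" k]
    by (simp add: rat_kernel_def mult_ac)
qed


text \<open>The series terminates because the factorial of q^(-n) vanishes beyond n, and its sign
  cancels against that of (-tq)^j. Passing \<open>a\<close> and \<open>b\<close> through equations
  allows a second use with the parameters exchanged.\<close>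

lemma p_rat_eq_sum:
  assumes t: "t > 0" and a: "q powr (\<alpha> + 1) = a" and b: "q powr (\<beta> + 1) = b"
  shows "p_rat q \<alpha> \<beta> n t = (\<Sum>j\<le>n. jacobi_coeff (a * b) n j *
    q ^ (j * (j - 1) div 2) * t ^ j / (qpoch a q j * qpoch (- (t * b)) q j))"
proof -
  have 1: "q powr (- real n) = 1 / q ^ n"
    using q by (simp add: powr_minus powr_realpow field_simps)
  have "real n + \<alpha> + \<beta> + 1 = (\<alpha> + 1) + (\<beta> + 1) + real n - 1"
    by simp
  then have 2: "q powr (real n + \<alpha> + \<beta> + 1) = a * b * q ^ n / q"
    unfolding a[symmetric] b[symmetric] using q
    by (simp only: powr_add powr_diff powr_realpow) simp
  have "qpoch (1 / q ^ n) q j = 0" if "j > n" for j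
    unfolding qpoch_def using q that by (intro prod_zero bexI[of _ n]) auto
  then have "p_rat q \<alpha> \<beta> n t = (\<Sum>j\<le>n. qpoch (1 / q ^ n) q j * qpoch (a * b * q ^ n / q) q j
      / (qpoch a q j * qpoch (- t * b) q j * qpoch q q j)
      * (- 1) ^ j * q ^ (j * (j - 1) div 2) * (- t * q) ^ j)"
    unfolding p_rat_def phi22_def 1 2 a b by (intro suminf_finite) auto
  also have "\<dots> = (\<Sum>j\<le>n. jacobi_coeff (a * b) n j *
    q ^ (j * (j - 1) div 2) * t ^ j / (qpoch a q j * qpoch (- (t * b)) q j))"
  proof (intro sum.cong refl)
    fix j
    have "(- t * q) ^ j = (- 1) ^ j * t ^ j * q ^ j"
      using power_mult_distrib[of "- 1" "t * q" j] by (simp add: power_mult_distrib)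
    moreover have "(- 1) ^ j * (- 1) ^ j = (1::real)"
      by (simp add: power_mult_distrib[symmetric])
    ultimately have "(- 1) ^ j * (- t * q) ^ j = t ^ j * q ^ j"
      by (simp add: mult.assoc[symmetric])
    then show "qpoch (1 / q ^ n) q j * qpoch (a * b * q ^ n / q) q j
      / (qpoch a q j * qpoch (- t * b) q j * qpoch q q j)
      * (- 1) ^ j * q ^ (j * (j - 1) div 2) * (- t * q) ^ j = jacobi_coeff (a * b) n j *
    q ^ (j * (j - 1) div 2) * t ^ j / (qpoch a q j * qpoch (- (t * b)) q j)"
      by (simp add: jacobi_coeff_def mult_ac)
  qed
  finally show ?thesis .
qed

lemma rat_weight_eq_kernel:
  "rat_weight q \<alpha> \<beta> t = rat_kernel q (q powr (\<alpha> + 1)) (q powr (\<beta> + 1)) t / t"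
proof -
  have "\<alpha> + 2 = (\<alpha> + 1) + 1" by simp
  then have "q powr (\<alpha> + 2) = q * q powr (\<alpha> + 1)"
    using q by (simp only: powr_add) simp
  then show ?thesis
    by (simp add: rat_weight_def rat_kernel_def divide_inverse mult_ac)
qed

text \<open>The monomial turns into a kernel on the lattice through s q^(j-k). Ramanujan's sum does
  not depend on the starting point, so neither does the value here.\<close>

lemma rat_kernel_monomial_has_sum:
  assumes "0 < a" "a < 1" "0 < b" "b < 1" "s > 0"
  shows "((\<lambda>i::int. q ^ (j * (j - 1) div 2) * q ^ (k * (k - 1) div 2) *
      ((s * q powi i) ^ j * (q / (s * q powi i)) ^ k
        * rat_kernel q (a * q ^ k) (b * q ^ j) (s * q powi i)) / (qpoch a q j * qpoch b q k))
    has_sum (q ^ (j * k) / qpoch (a * b) q (j + k) * (qpoch_inf q q * qbeta a b))) UNIV"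
proof -
  have t: "s * q powi i > 0" for i using assms q by simp
  define s' where "s' = s * q ^ j / q ^ k"
  have pos: "qpoch a q j > 0" "qpoch b q k > 0" "qpoch (a * b) q (j + k) > 0"
    using assms by (auto intro!: qpoch_pos mult_less_1)
  have "((\<lambda>i::int. rat_kernel q (a * q ^ j) (b * q ^ k) (s' * q powi i)) has_sum
    (qpoch_inf q q * qpoch_inf ((a * q ^ j) * (b * q ^ k)) q
      / (qpoch_inf (a * q ^ j) q * qpoch_inf (b * q ^ k) q))) UNIV"
    using assms q by (intro rat_kernel_has_sum q_mult_less_1) (auto simp: s'_def)
  also have "(a * q ^ j) * (b * q ^ k) = a * b * q ^ (j + k)"
    by (simp add: power_add mult_ac)
  also have "qpoch_inf q q * qpoch_inf (a * b * q ^ (j + k)) q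
      / (qpoch_inf (a * q ^ j) q * qpoch_inf (b * q ^ k) q)
    = qpoch a q j * qpoch b q k / qpoch (a * b) q (j + k) * (qpoch_inf q q * qbeta a b)"
    using pos qpoch_inf_split[of a j] qpoch_inf_split[of b k] qpoch_inf_split[of "a * b" "j + k"]
    by (simp add: qbeta_def)
  finally have "((\<lambda>i::int. q ^ (j * k) / (qpoch a q j * qpoch b q k)
      * rat_kernel q (a * q ^ j) (b * q ^ k) (s' * q powi i)) has_sum
    (q ^ (j * k) / (qpoch a q j * qpoch b q k) *
     (qpoch a q j * qpoch b q k / qpoch (a * b) q (j + k) * (qpoch_inf q q * qbeta a b)))) UNIV"
    by (rule has_sum_cmult_right)
  moreover have "q ^ (j * k) / (qpoch a q j * qpoch b q k)
      * rat_kernel q (a * q ^ j) (b * q ^ k) (s' * q powi i) =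
    q ^ (j * (j - 1) div 2) * q ^ (k * (k - 1) div 2) *
      ((s * q powi i) ^ j * (q / (s * q powi i)) ^ k
        * rat_kernel q (a * q ^ k) (b * q ^ j) (s * q powi i)) / (qpoch a q j * qpoch b q k)" for i
    unfolding rat_kernel_monomial[OF t] by (simp add: s'_def mult_ac)
  ultimately show ?thesis
    using pos by simp
qed

lemma rat_jacobi_has_sum:
  assumes "\<alpha> > -1" "\<beta> > -1" "s > 0"
    and a: "q powr (\<alpha> + 1) = a" and b: "q powr (\<beta> + 1) = b"
  shows "((\<lambda>i::int. s * q powi i *
      (p_rat q \<alpha> \<beta> n (s * q powi i) * p_rat q \<beta> \<alpha> m (inverse (s * q powi i) * q)
        * rat_weight q \<alpha> \<beta> (s * q powi i)))
    has_sum ((\<Sum>j\<le>n. \<Sum>k\<le>m. jacobi_coeff (a * b) n j * jacobi_coeff (a * b) m k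
      * q ^ (j * k) / qpoch (a * b) q (j + k)) * (qpoch_inf q q * qbeta a b))) UNIV"
proof -
  have ab: "0 < a" "a < 1" "0 < b" "b < 1"
    using assms q by (auto simp flip: a b intro!: q_powr_less_1)
  define g where "g j k t = q ^ (j * (j - 1) div 2) * q ^ (k * (k - 1) div 2) *
      (t ^ j * (q / t) ^ k * rat_kernel q (a * q ^ k) (b * q ^ j) t) / (qpoch a q j * qpoch b q k)" for j k t
  have "t * (p_rat q \<alpha> \<beta> n t * p_rat q \<beta> \<alpha> m (inverse t * q) * rat_weight q \<alpha> \<beta> t)
    = (\<Sum>j\<le>n. \<Sum>k\<le>m. jacobi_coeff (a * b) n j * jacobi_coeff (a * b) m k * g j k t)"
    if t: "t > 0" for t
  proof -
    have qt: "inverse t * q = q / t" "q / t > 0" using t q by (auto simp: field_simps)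
    have "t * (p_rat q \<alpha> \<beta> n t * p_rat q \<beta> \<alpha> m (inverse t * q) * rat_weight q \<alpha> \<beta> t)
      = p_rat q \<alpha> \<beta> n t * p_rat q \<beta> \<alpha> m (q / t) * rat_kernel q a b t"
      unfolding rat_weight_eq_kernel a b qt(1) using t by simp
    also have "\<dots> = (\<Sum>j\<le>n. \<Sum>k\<le>m. jacobi_coeff (a * b) n j * jacobi_coeff (a * b) m k * g j k t)"
      unfolding p_rat_eq_sum[OF t a b] p_rat_eq_sum[OF qt(2) b a] sum_product
      unfolding sum_distrib_right
    proof (intro sum.cong refl)
      fix j k
      have "q / t * a = q * a / t" by simp
      then show "jacobi_coeff (a * b) n j * q ^ (j * (j - 1) div 2) * t ^ j / (qpoch a q j * qpoch (- (t * b)) q j) *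
         (jacobi_coeff (b * a) m k * q ^ (k * (k - 1) div 2) * (q / t) ^ k /
          (qpoch b q k * qpoch (- (q / t * a)) q k)) * rat_kernel q a b t =
         jacobi_coeff (a * b) n j * jacobi_coeff (a * b) m k * g j k t"
        unfolding g_def rat_kernel_qpoch[OF t ab(1,3), of j k, symmetric]
        by (simp only: times_divide_eq_left times_divide_eq_right divide_divide_eq_left mult_ac)
    qed
    finally show ?thesis .
  qed
  from this[of "s * q powi i" for i] have eq: "s * q powi i * (p_rat q \<alpha> \<beta> n (s * q powi i) * p_rat q \<beta> \<alpha> m (inverse (s * q powi i) * q)
        * rat_weight q \<alpha> \<beta> (s * q powi i))
    = (\<Sum>j\<le>n. \<Sum>k\<le>m. jacobi_coeff (a * b) n j * jacobi_coeff (a * b) m k * g j k (s * q powi i))" for i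
    using assms q by (simp only: zero_less_power_int mult_pos_pos)
  show ?thesis
    unfolding eq sum_distrib_right
  proof (intro has_sum_finite_sum)
    fix j k
    show "((\<lambda>i. jacobi_coeff (a * b) n j * jacobi_coeff (a * b) m k * g j k (s * q powi i)) has_sum
      jacobi_coeff (a * b) n j * jacobi_coeff (a * b) m k * q ^ (j * k) / qpoch (a * b) q (j + k)
        * (qpoch_inf q q * qbeta a b)) UNIV"
      using has_sum_cmult_right[OF rat_kernel_monomial_has_sum[OF ab assms(3), of j k],
          of "jacobi_coeff (a * b) n j * jacobi_coeff (a * b) m k"]
      unfolding g_def by (simp add: mult.assoc)
  qed auto
qed

section \<open>Normalising constant and conclusion\<close>

lemma q_Gamma_qbeta:
  assumes "\<alpha> > -1" "\<beta> > -1"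
    and a: "q powr (\<alpha> + 1) = a" and b: "q powr (\<beta> + 1) = b"
  shows "q_Gamma q (\<alpha> + \<beta> + 2) / (q_Gamma q (\<alpha> + 1) * q_Gamma q (\<beta> + 1)) *
    ((1 - q) * (qpoch_inf q q * qbeta a b)) = 1"
proof -
  have ab: "0 < a" "a < 1" "0 < b" "b < 1"
    using assms q by (auto simp flip: a b intro!: q_powr_less_1)
  have "\<alpha> + \<beta> + 2 = (\<alpha> + 1) + (\<beta> + 1)" by simp
  then have c: "q powr (\<alpha> + \<beta> + 2) = a * b"
    unfolding a[symmetric] b[symmetric] by (simp only: powr_add)
  have "qpoch_inf a q > 0" "qpoch_inf b q > 0" "qpoch_inf (a * b) q > 0" "qpoch_inf q q > 0"
    using ab q by (auto intro!: qpoch_inf_pos mult_less_1)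
  moreover define u v w where "u = (1 - q) powr (1 - (\<alpha> + 1))" and "v = (1 - q) powr (1 - (\<beta> + 1))"
    and "w = (1 - q) powr (1 - (\<alpha> + \<beta> + 2))"
  moreover have "u > 0" "v > 0"
    using q by (auto simp: u_def v_def)
  \<comment> \<open>The factor 1 - q in front of the q-integral balances the powers of 1 - q in the
    three q-gamma values.\<close>
  moreover have "w * (1 - q) = u * v"
  proof -
    have "w * (1 - q) = (1 - q) powr (1 - (\<alpha> + \<beta> + 2) + 1)"
      unfolding w_def using q by (simp only: powr_add) simp
    then show ?thesis
      unfolding u_def v_def powr_add[symmetric] by (simp add: algebra_simps)
  qed
  ultimately show ?thesis
    unfolding q_Gamma_def a b c qbeta_def u_def[symmetric] v_def[symmetric] w_def[symmetric]
    by (simp add: mult.assoc[symmetric])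
qed

end

theorem theorem1p3:
  fixes q \<alpha> \<beta> s :: real and n m :: nat
  assumes "0 < q" and "q < 1" and "\<alpha> > -1" and "\<beta> > -1" and "s > 0"
  shows "q_integrable q s
           (\<lambda>t. p_rat q \<alpha> \<beta> n t * p_rat q \<beta> \<alpha> m (inverse t * q) * rat_weight q \<alpha> \<beta> t)
    \<and> q_Gamma q (\<alpha> + \<beta> + 2) / (q_Gamma q (\<alpha> + 1) * q_Gamma q (\<beta> + 1))
        * q_integral q s
            (\<lambda>t. p_rat q \<alpha> \<beta> n t * p_rat q \<beta> \<alpha> m (inverse t * q) * rat_weight q \<alpha> \<beta> t)
      = (- 1) ^ n
        * (if n = 0 then 1
           else (1 - q powr (real n + \<alpha> + \<beta> + 1)) / (1 - q powr (2 * real n + \<alpha> + \<beta> + 1)))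
        * qpoch q q n * (if n = m then 1 else 0)
        / (q ^ (n * (n - 1) div 2) * qpoch (q powr (\<alpha> + \<beta> + 2)) q n)"
proof -
  define a where "a = q powr (\<alpha> + 1)"
  define b where "b = q powr (\<beta> + 1)"
  define C where "C = qpoch_inf q q * qbeta q a b"
  let ?S = "\<Sum>j\<le>n. \<Sum>k\<le>m. jacobi_coeff q (a * b) n j * jacobi_coeff q (a * b) m k
      * q ^ (j * k) / qpoch (a * b) q (j + k)"
  let ?G = "q_Gamma q (\<alpha> + \<beta> + 2) / (q_Gamma q (\<alpha> + 1) * q_Gamma q (\<beta> + 1))"
  let ?f = "\<lambda>t. p_rat q \<alpha> \<beta> n t * p_rat q \<beta> \<alpha> m (inverse t * q) * rat_weight q \<alpha> \<beta> t"
  have ab: "0 < a" "a < 1" "0 < b" "b < 1"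
    using assms by (auto simp: a_def b_def intro!: q_powr_less_1)
  \<comment> \<open>This one statement supplies both claims: unconditional summability of a real
    family is absolute summability, and the sum gives the integral.\<close>
  have sum: "((\<lambda>i::int. s * q powi i * ?f (s * q powi i)) has_sum ?S * C) UNIV"
    unfolding C_def using assms by (intro rat_jacobi_has_sum) (auto simp: a_def b_def)
  then have "q_integrable q s ?f"
    unfolding q_integrable_def
    using has_sum_imp_summable[OF sum] by (subst (asm) summable_on_iff_abs_summable_on_real) simp
  moreover have "?G * q_integral q s ?f = ?S"
  proof -
    have "q_integral q s ?f = (1 - q) * (?S * C)"
      unfolding q_integral_def using sum by (simp only: infsumI)
    then have "?G * q_integral q s ?f = ?S * (?G * ((1 - q) * C))"
      by (simp only: mult_ac)
    also have "?G * ((1 - q) * C) = 1"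
      unfolding C_def using assms by (intro q_Gamma_qbeta) (auto simp: a_def b_def)
    finally show ?thesis by simp
  qed
  moreover have "?S = (- 1) ^ n * (if n = 0 then 1 else (1 - a * b * q ^ n / q) / (1 - a * b * q ^ (2 * n) / q))
      * qpoch q q n * (if n = m then 1 else 0) / (q ^ (n * (n - 1) div 2) * qpoch (a * b) q n)"
    using assms ab by (intro jacobi_coeff_orthogonal mult_less_1) auto
  \<comment> \<open>Used for l = n and l = 2n, this converts the real exponents of the statement to
    the form in \<open>jacobi_coeff_orthogonal\<close>.\<close>
  moreover have "q powr (real l + \<alpha> + \<beta> + 1) = a * b * q ^ l / q" for l
  proof -
    have "real l + \<alpha> + \<beta> + 1 = (\<alpha> + 1) + (\<beta> + 1) + real l - 1" by simp
    then show ?thesis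
      unfolding a_def b_def using assms by (simp only: powr_add powr_diff powr_realpow) simp
  qed
  from this[of n] this[of "2 * n"]
  have "q powr (real n + \<alpha> + \<beta> + 1) = a * b * q ^ n / q"
    "q powr (2 * real n + \<alpha> + \<beta> + 1) = a * b * q ^ (2 * n) / q"
    by simp_all
  moreover have "q powr (\<alpha> + \<beta> + 2) = a * b"
    unfolding a_def b_def powr_add[symmetric] by (simp add: add_ac)
  ultimately show ?thesis
    by (simp only: simp_thms)
qed

end
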